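(* Let $1\le k\le n$ be integers, let $\sigma_{\mathrm{id}}$ be the identity permutation in $S_k$, and let $$R^{NF}=R^{\sigma_{\mathrm{id}}}\setminus\bigcup_{\sigma\in S_k,\ \sigma\ne\sigma_{\mathrm{id}}}R^{\sigma}.$$ Then $$\sum_{(F_1,\dots,F_k)\in R_{\{0\}}\times (R_{[k]})^{k-1}}\ \prod_{i=1}^k a_{F_i}\;=\;\sum_{(F_1,\dots,F_k)\in R^{NF}}\ \prod_{i=1}^k a_{F_i}.$$
   Context: All graphs have node set $\{0,1,\dots,n\}$ and are subgraphs of the complete directed graph (without loops) on these nodes. Each directed edge $i\to j$ ($i\neq j$) carries a weight $a_{ij}$ in a commutative ring (e.g. commuting indeterminates). A directed rooted forest is an acyclic directed graph in which every node has at most one out-edge; the nodes with no out-edge are the roots, so each node lies in the tree of exactly one root, reached by following out-edges. The weight $a_F$ of a forest $F$ is the product of the weights of its edges (the empty product is $1$). Notation: $[k]=\{0,1,\dots,k\}$. $S_k$ is the group of permutations of $\{1,\dots,k\}$. For a set $U$ of nodes, $R_U$ is the set of directed rooted forests on $\{0,\dots,n\}$ whose set of roots is exactly $U$. A meta-edge $i\to j$ in a forest is a directed path from $i$ to $j$; the path of length zero counts, so the meta-edge $i\to i$ is always present. $R_U^{i\to j}$ is the set of forests in $R_U$ having a meta-edge $i\to j$; in particular $R_U^{i\to i}=R_U$. For $\sigma\in S_k$, $$R^{\sigma}=R_{[k]\setminus\{1\}}^{1\to\sigma(1)}\times R_{[k]\setminus\{2\}}^{2\to\sigma(2)}\times\cdots\times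 R_{[k]\setminus\{k\}}^{k\to\sigma(k)},$$ a set of ordered $k$-tuples of forests. *)

theory Defs
  imports "HOL-Library.FuncSet" "HOL-Combinatorics.Permutations"
begin

text \<open>
  The node set \<open>{0..n}\<close> is fixed, so a directed graph on it is represented by its edge
  relation; a pair \<open>(i, j)\<close> is the edge \<open>i \<rightarrow> j\<close>. Acyclicity already rules out loops.
\<close>

definition rooted_forest :: "nat \<Rightarrow> (nat \<times> nat) set \<Rightarrow> bool" where
  "rooted_forest n F \<longleftrightarrow> F \<subseteq> {0..n} \<times> {0..n} \<and> acyclic F \<and> single_valued F"

definition forest_roots :: "nat \<Rightarrow> (nat \<times> nat) set \<Rightarrow> nat set" where
  "forest_roots n F = {0..n} - Domain F"

definition rforests :: "nat \<Rightarrow> nat set \<Rightarrow> (nat \<times> nat) set set" where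
  "rforests n U = {F. rooted_forest n F \<and> forest_roots n F = U}"

text \<open>
  A meta-edge is a directed path, possibly of length zero, hence the reflexive transitive closure.
\<close>

definition meta_edge :: "(nat \<times> nat) set \<Rightarrow> nat \<Rightarrow> nat \<Rightarrow> bool" where
  "meta_edge F i j \<longleftrightarrow> (i, j) \<in> F\<^sup>*"

definition rforests_meta :: "nat \<Rightarrow> nat set \<Rightarrow> nat \<Rightarrow> nat \<Rightarrow> (nat \<times> nat) set set" where
  "rforests_meta n U i j = {F \<in> rforests n U. meta_edge F i j}"

definition forest_weight :: "(nat \<Rightarrow> nat \<Rightarrow> 'a::comm_ring_1) \<Rightarrow> (nat \<times> nat) set \<Rightarrow> 'a" where
  "forest_weight a F = (\<Prod>(i, j)\<in>F. a i j)"

text \<open>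
  Ordered \<open>k\<close>-tuples are extensional functions on the index set \<open>{1..k}\<close>.
\<close>

definition R_perm :: "nat \<Rightarrow> nat \<Rightarrow> (nat \<Rightarrow> nat) \<Rightarrow> (nat \<Rightarrow> (nat \<times> nat) set) set" where
  "R_perm n k \<sigma> = (\<Pi>\<^sub>E i\<in>{1..k}. rforests_meta n ({0..k} - {i}) i (\<sigma> i))"

definition R_NF :: "nat \<Rightarrow> nat \<Rightarrow> (nat \<Rightarrow> (nat \<times> nat) set) set" where
  "R_NF n k = R_perm n k id - (\<Union>\<sigma>\<in>{\<sigma>. \<sigma> permutes {1..k} \<and> \<sigma> \<noteq> id}. R_perm n k \<sigma>)"

text \<open>
  The product of one factor \<open>R\<^bsub>{0}\<^esub>\<close>, in position 1, and \<open>k - 1\<close> factors \<open>R\<^bsub>{0..k}\<^esub>\<close>.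
\<close>

definition R_prod :: "nat \<Rightarrow> nat \<Rightarrow> (nat \<Rightarrow> (nat \<times> nat) set) set" where
  "R_prod n k = (\<Pi>\<^sub>E i\<in>{1..k}. if i = 1 then rforests n {0} else rforests n {0..k})"

lemma finite_rforests: "finite (rforests n U)"
  by (rule finite_subset[of _ "Pow ({0..n} \<times> {0..n})"])
    (auto simp: rforests_def rooted_forest_def)

lemma rforests_meta_refl: "rforests_meta n U i i = rforests n U"
  by (simp add: rforests_meta_def meta_edge_def)

lemma finite_R_prod: "finite (R_prod n k)"
  unfolding R_prod_def by (rule finite_PiE) (auto simp: finite_rforests)

lemma finite_R_NF: "finite (R_NF n k)"
  unfolding R_NF_def R_perm_def
  by (rule finite_Diff, rule finite_PiE) (auto simp: rforests_meta_def finite_rforests)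

end

theory Submission
  imports Defs
begin

text \<open>
  A forest is a choice \<open>f\<close> of one out-edge for every non-root such that following \<open>f\<close> always
  ends in a root. Let \<open>W\<close> be the weighted number of forests with roots \<open>{0..k}\<close>, and \<open>w i j\<close> that of
  forests with roots \<open>{0..k} - {i}\<close> in which \<open>i\<close> leads to \<open>j\<close>. A tuple indexed by the identity
  records for each \<open>i\<close> the root \<open>\<tau> i\<close> reached from \<open>i\<close> in the \<open>i\<close>-th forest; it also belongs to some
  \<open>\<sigma> \<noteq> id\<close> iff \<open>\<tau>\<close> has a cycle. Hence the right-hand side is the sum of \<open>\<Prod>i. w i (\<tau> i)\<close> over the
  trees \<open>\<tau>\<close> on \<open>{0..k}\<close> rooted at \<open>0\<close>.

  These trees arise from the spanning trees of \<open>{0..n}\<close> by replacing, for one \<open>i\<close> after the other,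
  the weights \<open>a i\<close> of the out-edges of \<open>i\<close> by \<open>w i\<close>. Each replacement multiplies the sum by \<open>W\<close>.
  Only \<open>k - 1\<close> of them are needed, since the last \<open>w i\<close> is built from the out-edges of \<open>{k+1..n}\<close>
  already present. For a single replacement, leave the out-edge of \<open>i\<close> open and let \<open>h l\<close> be the
  weighted number of forests in which \<open>l\<close> does not lead to \<open>i\<close>. This \<open>h\<close> is harmonic at every
  non-root, so telescoping along the paths from \<open>l\<close> shows that \<open>W * h l\<close> is the weighted sum of
  \<open>h (root l)\<close> over the forests with roots \<open>{0..k}\<close>.
\<close>

section \<open>Functional forests\<close>

text \<open>Points outside \<open>D\<close> are the roots, and \<open>f\<close> is ignored there.
  Being inductive, \<open>leads\<close> gives no end point to a walk that stays in \<open>D\<close>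
  forever.\<close>

inductive leads :: "'v set \<Rightarrow> ('v \<Rightarrow> 'v) \<Rightarrow> 'v \<Rightarrow> 'v \<Rightarrow> bool" for D f where
  stop: "x \<notin> D \<Longrightarrow> leads D f x x"
| step: "x \<in> D \<Longrightarrow> leads D f (f x) y \<Longrightarrow> leads D f x y"

definition terminating :: "'v set \<Rightarrow> ('v \<Rightarrow> 'v) \<Rightarrow> bool" where
  "terminating D f \<longleftrightarrow> (\<forall>x. \<exists>y. leads D f x y)"

definition root :: "'v set \<Rightarrow> ('v \<Rightarrow> 'v) \<Rightarrow> 'v \<Rightarrow> 'v" where
  "root D f x = (THE y. leads D f x y)"

lemma leads_notin: "leads D f x y \<Longrightarrow> y \<notin> D"
  by (induction rule: leads.induct)

lemma leads_unique: "leads D f x y \<Longrightarrow> leads D f x z \<Longrightarrow> y = z"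
proof (induction rule: leads.induct)
  case (stop x)
  then show ?case by (auto elim: leads.cases)
next
  case (step x y)
  then show ?case by (auto elim: leads.cases)
qed

lemma root_eqI: "leads D f x y \<Longrightarrow> root D f x = y"
  unfolding root_def by (blast intro: the_equality leads_unique)

lemma leads_root: "terminating D f \<Longrightarrow> leads D f x (root D f x)"
  unfolding terminating_def by (metis root_eqI)

lemma root_notin: "terminating D f \<Longrightarrow> root D f x \<notin> D"
  using leads_root leads_notin by metis

lemma root_stop [simp]: "x \<notin> D \<Longrightarrow> root D f x = x"
  by (rule root_eqI) (rule leads.stop)

lemma root_step: "terminating D f \<Longrightarrow> x \<in> D \<Longrightarrow> root D f x = root D f (f x)"
  by (rule root_eqI) (rule leads.step[OF _ leads_root])

lemma leads_mem:
  assumes "leads D f x y" "x \<in> N" "\<And>i. i \<in> D \<Longrightarrow> f i \<in> N"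
  shows "y \<in> N"
  using assms by (induction rule: leads.induct) auto

lemma not_leads_invariant:
  assumes "leads D f x y" "x \<in> S" "S \<subseteq> D" "f ` S \<subseteq> S"
  shows False
  using assms by (induction rule: leads.induct) auto

lemma leads_cong_imp:
  assumes "leads D f x y" "\<And>i. i \<in> D \<Longrightarrow> f i = g i"
  shows "leads D g x y"
  using assms by (induction rule: leads.induct) (auto intro: leads.intros)

lemma leads_cong:
  assumes "\<And>i. i \<in> D \<Longrightarrow> f i = g i"
  shows "leads D f = leads D g"
proof (intro ext iffI)
  fix x y
  show "leads D f x y \<Longrightarrow> leads D g x y" by (erule leads_cong_imp) (simp add: assms)
  show "leads D g x y \<Longrightarrow> leads D f x y" by (erule leads_cong_imp) (simp add: assms)
qed

lemma terminating_cong: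
  "(\<And>i. i \<in> D \<Longrightarrow> f i = g i) \<Longrightarrow> terminating D f \<longleftrightarrow> terminating D g"
  unfolding terminating_def using leads_cong[of D f g] by simp

lemma root_cong:
  "(\<And>i. i \<in> D \<Longrightarrow> f i = g i) \<Longrightarrow> root D f = root D g"
  unfolding root_def using leads_cong[of D f g] by simp

lemma terminating_mono:
  assumes "terminating D f" "D' \<subseteq> D"
  shows "terminating D' f"
proof -
  have "\<exists>z. leads D' f x z" if "leads D f x y" for x y
    using that
  proof (induction rule: leads.induct)
    case (stop x)
    then show ?case using assms(2) by (blast intro: leads.stop)
  next
    case (step x y)
    then show ?case using leads.step leads.stop by metis
  qed
  then show ?thesis using assms(1) unfolding terminating_def by blast
qed

text \<open>Stretches of the walk inside \<open>D1\<close> are contracted to their end points; what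
  remains is a walk on \<open>D2\<close> along \<open>f\<close> followed by
  \<open>root D1 f\<close>.\<close>

lemma leads_Un_iff:
  assumes disj: "D1 \<inter> D2 = {}" and trm: "terminating D1 f"
  shows "leads (D1 \<union> D2) f x y \<longleftrightarrow> leads D2 (\<lambda>z. root D1 f (f z)) (root D1 f x) y"
proof
  assume "leads (D1 \<union> D2) f x y"
  then show "leads D2 (\<lambda>z. root D1 f (f z)) (root D1 f x) y"
  proof (induction rule: leads.induct)
    case (stop x)
    then show ?case by (auto intro: leads.stop)
  next
    case (step x y)
    show ?case
    proof (cases "x \<in> D1")
      case True
      then show ?thesis using step root_step[OF trm] by simp
    next
      case False
      then show ?thesis using step by (auto intro: leads.step)
    qed
  qed
next
  have prepend: "leads (D1 \<union> D2) f x y"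
    if "leads D1 f x z" "leads (D1 \<union> D2) f z y" for x y z
    using that by (induction rule: leads.induct) (auto intro: leads.step)
  have lift: "leads (D1 \<union> D2) f z y"
    if "leads D2 (\<lambda>z. root D1 f (f z)) z y" "z \<notin> D1" for z y
    using that
  proof (induction rule: leads.induct)
    case (stop z)
    then show ?case by (auto intro: leads.stop)
  next
    case (step z y)
    have "leads (D1 \<union> D2) f (root D1 f (f z)) y"
      using step root_notin[OF trm] by blast
    then have "leads (D1 \<union> D2) f (f z) y"
      using prepend leads_root[OF trm] by blast
    then show ?case using step by (auto intro: leads.step)
  qed
  assume "leads D2 (\<lambda>z. root D1 f (f z)) (root D1 f x) y"
  then show "leads (D1 \<union> D2) f x y"
    using lift prepend leads_root[OF trm] root_notin[OF trm] by blast
qed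

lemma terminating_Un_iff:
  assumes disj: "D1 \<inter> D2 = {}"
  shows "terminating (D1 \<union> D2) f \<longleftrightarrow>
    terminating D1 f \<and> terminating D2 (\<lambda>z. root D1 f (f z))"
proof (cases "terminating D1 f")
  case False
  then show ?thesis using terminating_mono by blast
next
  case True
  let ?g = "\<lambda>z. root D1 f (f z)"
  have "\<exists>y. leads D2 ?g x y" if "terminating (D1 \<union> D2) f" for x
  proof (cases "x \<in> D1")
    case True
    then have "x \<notin> D2" using disj by blast
    then show ?thesis by (blast intro: leads.stop)
  next
    case False
    then show ?thesis
      using leads_root[OF that, of x] by (auto simp: leads_Un_iff[OF disj True])
  qed
  moreover have "\<exists>y. leads (D1 \<union> D2) f x y" if "terminating D2 ?g" for x
    using leads_root[OF that] by (auto simp: leads_Un_iff[OF disj True])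
  ultimately show ?thesis using True unfolding terminating_def by blast
qed

lemma root_Un:
  assumes "D1 \<inter> D2 = {}" "terminating (D1 \<union> D2) f"
  shows "root (D1 \<union> D2) f x = root D2 (\<lambda>z. root D1 f (f z)) (root D1 f x)"
proof (rule root_eqI)
  have D1: "terminating D1 f" and D2: "terminating D2 (\<lambda>z. root D1 f (f z))"
    using assms terminating_Un_iff by blast+
  show "leads (D1 \<union> D2) f x (root D2 (\<lambda>z. root D1 f (f z)) (root D1 f x))"
    unfolding leads_Un_iff[OF assms(1) D1] by (rule leads_root[OF D2])
qed

lemma terminating_empty [simp]: "terminating {} f"
  unfolding terminating_def by (blast intro: leads.stop)

lemma terminating_singleton: "terminating {u} f \<longleftrightarrow> f u \<noteq> u"
proof
  assume "terminating {u} f"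
  then show "f u \<noteq> u"
    using not_leads_invariant[of "{u}" f u _ "{u}"] unfolding terminating_def by auto
next
  assume "f u \<noteq> u"
  then have "leads {u} f u (f u)" by (simp add: leads.stop leads.step)
  then show "terminating {u} f" unfolding terminating_def
    by (metis leads.stop singletonD)
qed

lemma root_singleton: "f u \<noteq> u \<Longrightarrow> root {u} f x = (if x = u then f u else x)"
  by (cases "x = u") (simp_all add: root_eqI leads.stop leads.step)

lemma terminating_insert:
  assumes "u \<notin> D"
  shows "terminating (insert u D) f \<longleftrightarrow> terminating D f \<and> root D f (f u) \<noteq> u"
  using terminating_Un_iff[of D "{u}" f] assms by (simp add: terminating_singleton)

lemma root_insert:
  assumes "u \<notin> D" "terminating (insert u D) f"
  shows "root (insert u D) f x =
    (if root D f x = u then root D f (f u) else root D f x)"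
  using root_Un[of D "{u}" f x] assms terminating_insert[OF assms(1), of f]
  by (simp add: root_singleton)

lemma terminating_no_fixpoint:
  assumes "terminating D f" "i \<in> D"
  shows "f i \<noteq> i"
  using terminating_mono[OF assms(1), of "{i}"] assms(2) by (simp add: terminating_singleton)

lemma sum_PiE_insert:
  assumes "u \<notin> D"
  shows "(\<Sum>f\<in>insert u D \<rightarrow>\<^sub>E N. G f) = (\<Sum>f\<in>D \<rightarrow>\<^sub>E N. \<Sum>l\<in>N. G (f(u := l)))"
proof -
  have "(\<Sum>f\<in>insert u D \<rightarrow>\<^sub>E N. G f) = (\<Sum>(l, f)\<in>N \<times> (D \<rightarrow>\<^sub>E N). G (f(u := l)))"
    unfolding PiE_insert_eq
    by (subst sum.reindex) (use inj_combinator[OF assms] in \<open>auto simp: case_prod_unfold\<close>)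
  also have "\<dots> = (\<Sum>l\<in>N. \<Sum>f\<in>D \<rightarrow>\<^sub>E N. G (f(u := l)))"
    by (rule sum.cartesian_product[symmetric])
  also have "\<dots> = (\<Sum>f\<in>D \<rightarrow>\<^sub>E N. \<Sum>l\<in>N. G (f(u := l)))"
    by (rule sum.swap)
  finally show ?thesis .
qed

section \<open>Weighted sums over forests\<close>

text \<open>\<open>\<Phi>\<close> sees a forest only through its root map, which lets out-edges be
  added or opened one at a time. Loops drop out because they never terminate.\<close>

definition forest_sum ::
    "'v set \<Rightarrow> ('v \<Rightarrow> 'v \<Rightarrow> 'a::comm_ring_1) \<Rightarrow> 'v set \<Rightarrow> (('v \<Rightarrow> 'v) \<Rightarrow> 'a) \<Rightarrow> 'a" where
  "forest_sum N b D \<Phi> =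
    (\<Sum>f\<in>D \<rightarrow>\<^sub>E N. if terminating D f then (\<Prod>i\<in>D. b i (f i)) * \<Phi> (root D f) else 0)"

text \<open>Splits off the out-edge of \<open>u\<close> to \<open>l\<close>. It closes a cycle iff
  \<open>l\<close> leads to \<open>u\<close>; otherwise the whole tree of \<open>u\<close> is
  redirected to the root of \<open>l\<close>.\<close>

lemma forest_sum_insert:
  assumes "finite D" "u \<notin> D"
  shows "forest_sum N b (insert u D) \<Phi> =
    forest_sum N b D (\<lambda>r. \<Sum>l\<in>N. if r l = u then 0 else
      b u l * \<Phi> (\<lambda>x. if r x = u then r l else r x))"
proof -
  have summand: "(if terminating (insert u D) (f(u := l))
      then (\<Prod>i\<in>insert u D. b i ((f(u := l)) i)) * \<Phi> (root (insert u D) (f(u := l))) else 0) =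
    (if terminating D f then (\<Prod>i\<in>D. b i (f i)) * (if root D f l = u then 0 else
      b u l * \<Phi> (\<lambda>x. if root D f x = u then root D f l else root D f x)) else 0)" for f l
  proof -
    have r: "root D (f(u := l)) = root D f" by (rule root_cong) (use assms in auto)
    have t: "terminating D (f(u := l)) = terminating D f"
      by (rule terminating_cong) (use assms in auto)
    have p: "(\<Prod>i\<in>D. b i ((f(u := l)) i)) = (\<Prod>i\<in>D. b i (f i))"
      by (rule prod.cong) (use assms in auto)
    have T: "terminating (insert u D) (f(u := l)) \<longleftrightarrow> terminating D f \<and> root D f l \<noteq> u"
      using terminating_insert[OF assms(2), of "f(u := l)"] by (simp add: r t)
    have R: "root (insert u D) (f(u := l)) = (\<lambda>x. if root D f x = u then root D f l else root D f x)"
      if "terminating (insert u D) (f(u := l))"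
      using root_insert[OF assms(2) that] by (simp add: r fun_eq_iff)
    show ?thesis using T R assms p by (auto simp: mult_ac)
  qed
  show ?thesis
    unfolding forest_sum_def sum_PiE_insert[OF assms(2)] summand
    by (rule sum.cong) (auto simp: sum_distrib_left)
qed


lemma forest_sum_empty: "forest_sum N b {} \<Phi> = \<Phi> (\<lambda>x. x)"
proof -
  have "root {} f = (\<lambda>x. x)" for f :: "'a \<Rightarrow> 'a" by auto
  then show ?thesis by (simp add: forest_sum_def)
qed

lemma forest_sum_cong:
  assumes "\<And>f. f \<in> D \<rightarrow>\<^sub>E N \<Longrightarrow> terminating D f \<Longrightarrow> \<Phi> (root D f) = \<Psi> (root D f)"
  shows "forest_sum N b D \<Phi> = forest_sum N b D \<Psi>"
  unfolding forest_sum_def by (rule sum.cong) (auto simp: assms)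

lemma forest_sum_weight_cong:
  assumes "\<And>i j. i \<in> D \<Longrightarrow> b i j = c i j"
  shows "forest_sum N b D \<Phi> = forest_sum N c D \<Phi>"
  unfolding forest_sum_def by (rule sum.cong) (simp_all add: assms cong: prod.cong)

lemma forest_sum_zero: "forest_sum N b D (\<lambda>_. 0) = 0"
  by (simp add: forest_sum_def cong: if_cong)

lemma forest_sum_mult: "forest_sum N b D (\<lambda>r. c * \<Phi> r) = c * forest_sum N b D \<Phi>"
  unfolding forest_sum_def sum_distrib_left by (rule sum.cong) (auto simp: mult_ac)

lemma forest_sum_diff:
  "forest_sum N b D (\<lambda>r. \<Phi> r - \<Psi> r) = forest_sum N b D \<Phi> - forest_sum N b D \<Psi>"
  unfolding forest_sum_def sum_subtractf[symmetric]
  by (rule sum.cong) (auto simp: right_diff_distrib)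

lemma forest_sum_sum:
  "forest_sum N b D (\<lambda>r. \<Sum>j\<in>J. \<Phi> j r) = (\<Sum>j\<in>J. forest_sum N b D (\<Phi> j))"
  unfolding forest_sum_def
  by (subst sum.swap) (auto intro!: sum.cong simp: sum_distrib_left)

section \<open>Harmonicity\<close>

text \<open>The out-edge of \<open>u\<close> in the forest and the summation index \<open>j\<close>
  are both weighted by the row \<open>b u\<close>, so the terms cancel in pairs.\<close>

lemma forest_sum_harmonic:
  assumes "finite D" "u \<in> D"
  shows "(\<Sum>j\<in>N. b u j *
    (forest_sum N b D (\<lambda>r. \<phi> (r u)) - forest_sum N b D (\<lambda>r. \<phi> (r j)))) = 0"
proof -
  define D' where "D' = D - {u}"
  have D: "D = insert u D'" "u \<notin> D'" "finite D'"
    using assms by (auto simp: D'_def)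
  have "(\<Sum>j\<in>N. b u j *
      (forest_sum N b D (\<lambda>r. \<phi> (r u)) - forest_sum N b D (\<lambda>r. \<phi> (r j)))) =
    forest_sum N b D (\<lambda>r. \<Sum>j\<in>N. b u j * (\<phi> (r u) - \<phi> (r j)))"
    by (simp add: forest_sum_sum forest_sum_mult forest_sum_diff)
  also have "\<dots> = forest_sum N b D' (\<lambda>_. 0)"
    unfolding D(1) forest_sum_insert[OF D(3,2)]
  proof (rule forest_sum_cong)
    fix f
    define r where "r = root D' f"
    \<comment> \<open>\<open>P\<close> masks out-edges that would close a cycle. It may mask
      \<open>j\<close> as well: if \<open>j\<close> leads to \<open>u\<close>, both share the root
      \<open>r l\<close> and the difference is zero.\<close>
    define P where "P l = (if r l = u then 0 else b u l)" for l
    have "r u = u" unfolding r_def using D(2) by simp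
    then have "(\<Sum>l\<in>N. if r l = u then 0 else b u l * (\<Sum>j\<in>N. b u j *
        (\<phi> (if r u = u then r l else r u) - \<phi> (if r j = u then r l else r j)))) =
      (\<Sum>l\<in>N. \<Sum>j\<in>N. P l * \<phi> (r l) * P j - P l * (P j * \<phi> (r j)))"
      by (auto intro!: sum.cong simp: P_def sum_distrib_left algebra_simps)
    also have "\<dots> = 0" \<comment> \<open>the summand is antisymmetric in the two out-edges \<open>l\<close> and \<open>j\<close> of \<open>u\<close>\<close>
      by (simp add: sum_subtractf sum_product[symmetric])
    finally show "(\<Sum>l\<in>N. if root D' f l = u then 0 else b u l * (\<Sum>j\<in>N. b u j *
        (\<phi> (if root D' f u = u then root D' f l else root D' f u) -
         \<phi> (if root D' f j = u then root D' f l else root D' f j)))) = 0"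
      by (simp only: r_def)
  qed
  finally show ?thesis by (simp only: forest_sum_zero)
qed

section \<open>Telescoping over removable nodes\<close>

text \<open>The nodes \<open>u\<close> for which \<open>g\<close> arises from a forest in which \<open>v\<close> leads to the root \<open>u\<close> by adding an
  out-edge of \<open>u\<close>: if \<open>g\<close> is a forest, these form the path from \<open>v\<close>.\<close>

definition removable :: "'v set \<Rightarrow> ('v \<Rightarrow> 'v) \<Rightarrow> 'v \<Rightarrow> 'v set" where
  "removable E g v = {u \<in> E. terminating (E - {u}) g \<and> root (E - {u}) g v = u}"

text \<open>Along the path from \<open>v\<close> to its root the differences telescope; the
  induction strips off the first node of the path.\<close>

lemma sum_removable_terminating:
  fixes h :: "'v \<Rightarrow> 'a::comm_ring_1"
  assumes fin: "finite E" and T: "terminating E g"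
  shows "(\<Sum>u\<in>removable E g v. h u - h (g u)) = h v - h (root E g v)"
  using leads_root[OF T, of v]
proof (induction v "root E g v" rule: leads.induct)
  case (stop v)
  then have "removable E g v = {}" unfolding removable_def by auto
  with stop show ?case by simp
next
  case (step v)
  have T': "terminating (E - {u}) g" for u
    by (rule terminating_mono[OF T]) auto
  have E: "E = insert v (E - {v})" using step by auto
  have "root (E - {v}) g (g v) \<noteq> v"
    using T terminating_insert[of v "E - {v}" g] E by simp
  then have notin: "v \<notin> removable E g (g v)" by (simp add: removable_def)
  \<comment> \<open>For \<open>u \<noteq> v\<close> the out-edge of \<open>v\<close> is still
    present, so \<open>v\<close> and \<open>g v\<close> have the same root.\<close>
  have "u \<in> removable E g v \<longleftrightarrow> u = v \<or> u \<in> removable E g (g v)" for u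
    using root_step[OF T', of v u] step T' by (cases "u = v") (simp_all add: removable_def)
  then have "removable E g v = insert v (removable E g (g v))" by blast
  moreover have "finite (removable E g (g v))"
    using fin by (simp add: removable_def)
  ultimately show ?case
    using notin step root_step[OF T] by simp
qed

text \<open>If \<open>removable E g v\<close> is nonempty here, then it is the unique cycle of \<open>g\<close>, and the sum
  telescopes around it.\<close>

lemma sum_removable_cyclic:
  fixes h :: "'v \<Rightarrow> 'a::comm_ring_1"
  assumes fin: "finite E" and T: "\<not> terminating E g"
  shows "(\<Sum>u\<in>removable E g v. h u - h (g u)) = 0"
proof (cases "removable E g v = {}")
  case False
  \<comment> \<open>Any removable \<open>w\<close> lies on the cycle; opening \<open>g\<close> there
    leaves a forest on \<open>E'\<close>.\<close>
  then obtain w where w: "w \<in> E" "terminating (E - {w}) g" "root (E - {w}) g v = w"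
    unfolding removable_def by auto
  define E' where "E' = E - {w}"
  have E: "E = insert w E'" "w \<notin> E'" using w by (auto simp: E'_def)
  have T': "terminating E' g" and wv: "root E' g v = w" using w by (auto simp: E'_def)
  have wg: "root E' g (g w) = w"
    using T T' terminating_insert[OF E(2)] E(1) by simp
  \<comment> \<open>For every other \<open>u\<close>, removability in the cyclic \<open>g\<close>
    means lying on the path from \<open>g w\<close> back to \<open>w\<close> in the forest on
    \<open>E'\<close>.\<close>
  have iff: "terminating (E - {u}) g \<and> root (E - {u}) g v = u \<longleftrightarrow>
      terminating (E' - {u}) g \<and> root (E' - {u}) g (g w) = u" if u: "u \<in> E'" for u
  proof -
    define r where "r = root (E' - {u}) g"
    have E'u: "E' = insert u (E' - {u})" using u by auto
    have Eu: "E - {u} = insert w (E' - {u})" "w \<notin> E' - {u}" using E u by auto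
    have T'': "terminating (E' - {u}) g" by (rule terminating_mono[OF T']) auto
    have root_E': "root E' g x = (if r x = u then r (g u) else r x)" for x
      using root_insert[of u "E' - {u}" g x] T' E'u by (simp add: r_def)
    have term_Eu: "terminating (E - {u}) g \<longleftrightarrow> r (g w) \<noteq> w"
      using terminating_insert[OF Eu(2), of g] T'' by (simp add: r_def Eu(1))
    have root_Eu: "root (E - {u}) g x = (if r x = w then r (g w) else r x)"
      if "terminating (E - {u}) g" for x
      using root_insert[OF Eu(2), of g x] that by (simp add: r_def Eu(1))
    have "u \<noteq> w" using u E(2) by auto
    show ?thesis
      using wv wg root_E'[of v] root_E'[of "g w"] term_Eu root_Eu[of v] \<open>u \<noteq> w\<close> T''
      by (auto simp: r_def[symmetric] split: if_splits)
  qed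
  have "w \<in> removable E g v" using w by (simp add: removable_def)
  then have "removable E g v = insert w (removable E' g (g w))"
    using iff E by (auto simp: removable_def)
  moreover have "w \<notin> removable E' g (g w)" "finite (removable E' g (g w))"
    using E fin by (auto simp: removable_def)
  moreover have "finite E'" using fin E by simp
  \<comment> \<open>The path contributes \<open>h (g w) - h w\<close>, which cancels the term of
    \<open>w\<close>.\<close>
  ultimately show ?thesis
    using sum_removable_terminating[OF _ T', of h "g w"] wg by simp
qed simp

text \<open>\<open>h v - h (r v)\<close> is a telescoping sum over removable nodes. Cyclic maps
  contribute zero and can be included, so the out-edge of each \<open>u\<close> ranges freely over
  \<open>N\<close> and harmonicity at \<open>u\<close> annihilates its total contribution.\<close>

lemma forest_sum_root_harmonic:
  fixes h :: "'v \<Rightarrow> 'a::comm_ring_1"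
  assumes fin: "finite E"
    and harmonic: "\<And>u. u \<in> E \<Longrightarrow> (\<Sum>l\<in>N. b u l * (h u - h l)) = 0"
  shows "forest_sum N b E (\<lambda>r. h (r v)) = forest_sum N b E (\<lambda>_. 1) * h v"
proof -
  have "forest_sum N b E (\<lambda>r. h v - h (r v)) =
      (\<Sum>g\<in>E \<rightarrow>\<^sub>E N. (\<Prod>i\<in>E. b i (g i)) * (\<Sum>u\<in>removable E g v. h u - h (g u)))"
    unfolding forest_sum_def
    by (rule sum.cong) (simp_all add: sum_removable_terminating sum_removable_cyclic fin)
  also have "\<dots> = (\<Sum>g\<in>E \<rightarrow>\<^sub>E N. \<Sum>u\<in>E.
      if u \<in> removable E g v then (\<Prod>i\<in>E. b i (g i)) * (h u - h (g u)) else 0)"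
  proof (rule sum.cong)
    fix g
    have "{u \<in> E. u \<in> removable E g v} = removable E g v" by (auto simp: removable_def)
    then have "(\<Sum>u\<in>removable E g v. h u - h (g u)) =
        (\<Sum>u\<in>E. if u \<in> removable E g v then h u - h (g u) else 0)"
      using sum.inter_filter[OF fin, of "\<lambda>u. h u - h (g u)" "\<lambda>u. u \<in> removable E g v"]
      by simp
    then show "(\<Prod>i\<in>E. b i (g i)) * (\<Sum>u\<in>removable E g v. h u - h (g u)) =
        (\<Sum>u\<in>E. if u \<in> removable E g v then (\<Prod>i\<in>E. b i (g i)) * (h u - h (g u)) else 0)"
      by (auto simp: sum_distrib_left intro!: sum.cong)
  qed simp
  also have "\<dots> = (\<Sum>u\<in>E. \<Sum>g\<in>E \<rightarrow>\<^sub>E N.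
      if u \<in> removable E g v then (\<Prod>i\<in>E. b i (g i)) * (h u - h (g u)) else 0)"
    by (rule sum.swap)
  also have "\<dots> = (\<Sum>u\<in>E. 0)"
  proof (rule sum.cong)
    fix u assume u: "u \<in> E"
    define E' where "E' = E - {u}"
    have E: "E = insert u E'" "u \<notin> E'" "finite E'" using u fin by (auto simp: E'_def)
    \<comment> \<open>Removability of \<open>u\<close> depends only on the out-edges of the other
      nodes.\<close>
    have removable_upd: "u \<in> removable E (g(u := l)) v \<longleftrightarrow> u \<in> removable E g v" for g l
    proof -
      have "terminating E' (g(u := l)) = terminating E' g" "root E' (g(u := l)) = root E' g"
        using E(2) by (auto intro!: terminating_cong root_cong)
      then show ?thesis by (simp add: removable_def E'_def)
    qed
    have prod_upd: "(\<Prod>i\<in>E. b i ((g(u := l)) i)) = b u l * (\<Prod>i\<in>E'. b i (g i))" for g l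
    proof -
      have "(\<Prod>i\<in>E'. b i ((g(u := l)) i)) = (\<Prod>i\<in>E'. b i (g i))"
        by (rule prod.cong) (use E(2) in auto)
      then show ?thesis using E by simp
    qed
    have "(\<Sum>g\<in>E \<rightarrow>\<^sub>E N.
        if u \<in> removable E g v then (\<Prod>i\<in>E. b i (g i)) * (h u - h (g u)) else 0) =
      (\<Sum>g\<in>E' \<rightarrow>\<^sub>E N. \<Sum>l\<in>N. if u \<in> removable E (g(u := l)) v
        then (\<Prod>i\<in>E. b i ((g(u := l)) i)) * (h u - h ((g(u := l)) u)) else 0)"
      unfolding E(1) by (rule sum_PiE_insert[OF E(2)])
    also have "\<dots> = (\<Sum>g\<in>E' \<rightarrow>\<^sub>E N. if u \<in> removable E g v
        then (\<Prod>i\<in>E'. b i (g i)) * (\<Sum>l\<in>N. b u l * (h u - h l)) else 0)"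
      unfolding removable_upd prod_upd
      by (auto intro!: sum.cong simp: sum_distrib_left mult_ac)
    finally show "(\<Sum>g\<in>E \<rightarrow>\<^sub>E N.
        if u \<in> removable E g v then (\<Prod>i\<in>E. b i (g i)) * (h u - h (g u)) else 0) = 0"
      using harmonic[OF u] by (simp cong: if_cong)
  qed simp
  finally have "forest_sum N b E (\<lambda>r. h v * 1 - h (r v)) = 0" by simp
  then show ?thesis
    unfolding forest_sum_diff forest_sum_mult by (simp add: mult.commute)
qed


section \<open>Condensation onto the roots\<close>

text \<open>This is \<open>w i j\<close> of the introduction when \<open>N = {0..n}\<close> and
  \<open>I = {k+1..n}\<close>; the node \<open>i\<close> joins the non-roots
  \<open>I\<close>.\<close>

definition meta_weight ::
    "'v set \<Rightarrow> ('v \<Rightarrow> 'v \<Rightarrow> 'a::comm_ring_1) \<Rightarrow> 'v set \<Rightarrow> 'v \<Rightarrow> 'v \<Rightarrow> 'a" where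
  "meta_weight N a I i j = forest_sum N a (insert i I) (\<lambda>r. if r i = j then 1 else 0)"

text \<open>Groups the forests by the root that \<open>i\<close> reaches.\<close>

lemma sum_meta_weight:
  assumes "finite N" "i \<in> N" "I \<subseteq> N"
  shows "(\<Sum>j\<in>N. meta_weight N a I i j * h j) = forest_sum N a (insert i I) (\<lambda>r. h (r i))"
proof -
  have "(\<Sum>j\<in>N. meta_weight N a I i j * h j) =
      forest_sum N a (insert i I) (\<lambda>r. \<Sum>j\<in>N. h j * (if r i = j then 1 else 0))"
    unfolding forest_sum_sum forest_sum_mult meta_weight_def by (simp add: mult.commute)
  also have "\<dots> = forest_sum N a (insert i I) (\<lambda>r. h (r i))"
  proof (rule forest_sum_cong)
    fix f assume f: "f \<in> insert i I \<rightarrow>\<^sub>E N" "terminating (insert i I) f"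
    have "root (insert i I) f i \<in> N"
      using leads_mem[OF leads_root[OF f(2)] assms(2)] f(1) by blast
    then show "(\<Sum>j\<in>N. h j * (if root (insert i I) f i = j then 1 else 0)) =
        h (root (insert i I) f i)"
      using assms(1) by (simp add: if_distrib cong: if_cong)
  qed
  finally show ?thesis .
qed

lemma meta_weight_nonroot:
  fixes a :: "'v \<Rightarrow> 'v \<Rightarrow> 'a::comm_ring_1"
  assumes "j \<in> insert i I"
  shows "meta_weight N a I i j = 0"
proof -
  have "meta_weight N a I i j = forest_sum N a (insert i I) (\<lambda>_. 0)"
    unfolding meta_weight_def
  proof (rule forest_sum_cong)
    fix f assume "terminating (insert i I) f"
    from root_notin[OF this, of i] assms
    show "(if root (insert i I) f i = j then 1 else 0) = (0::'a)" by auto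
  qed
  then show ?thesis by (simp add: forest_sum_zero)
qed

text \<open>Both sums are linear in the row of \<open>i\<close>, with the same coefficients
  \<open>h l\<close>: the weight of the forests on \<open>D\<close> in which \<open>l\<close> does
  not lead to \<open>i\<close>. As \<open>h\<close> is harmonic on \<open>I\<close>, summing
  \<open>h\<close> at the roots reached from \<open>l\<close> gives \<open>h l\<close> times
  \<open>forest_sum N a I (\<lambda>_. 1)\<close>.\<close>

lemma forest_sum_meta_row:
  fixes a b :: "'v \<Rightarrow> 'v \<Rightarrow> 'a::comm_ring_1"
  assumes fin: "finite N" "finite D"
    and sub: "I \<subseteq> D" "D \<subseteq> N" "i \<in> N" "i \<notin> D"
    and b: "\<And>u. u \<in> I \<Longrightarrow> b u = a u"
  shows "forest_sum N (b(i := meta_weight N a I i)) (insert i D) (\<lambda>_. 1) =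
    forest_sum N a I (\<lambda>_. 1) * forest_sum N (b(i := a i)) (insert i D) (\<lambda>_. 1)"
proof -
  define h where "h x = forest_sum N b D (\<lambda>r. if r x = i then 0 else 1)" for x
  have finI: "finite I" and iI: "i \<notin> I" and IN: "I \<subseteq> N"
    using sub fin finite_subset by auto
  have row: "forest_sum N (b(i := c)) (insert i D) (\<lambda>_. 1) = (\<Sum>l\<in>N. c l * h l)" for c
  proof -
    have "forest_sum N (b(i := c)) (insert i D) (\<lambda>_. 1) =
        forest_sum N (b(i := c)) D (\<lambda>r. \<Sum>l\<in>N. c l * (if r l = i then 0 else 1))"
      unfolding forest_sum_insert[OF fin(2) sub(4)]
      by (rule forest_sum_cong) (auto intro!: sum.cong)
    also have "\<dots> = forest_sum N b D (\<lambda>r. \<Sum>l\<in>N. c l * (if r l = i then 0 else 1))"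
      by (rule forest_sum_weight_cong) (use sub(4) in auto)
    finally show ?thesis unfolding forest_sum_sum forest_sum_mult h_def .
  qed
  \<comment> \<open>Because \<open>h\<close> vanishes at \<open>i\<close>, targets leading to
    \<open>i\<close> contribute zero, which matches the cycle condition in
    \<open>forest_sum_insert\<close>.\<close>
  have "h i = forest_sum N b D (\<lambda>_. 0)"
    unfolding h_def by (rule forest_sum_cong) (use sub(4) in auto)
  then have hi: "h i = 0" by (simp only: forest_sum_zero)
  have harmonic: "(\<Sum>l\<in>N. a u l * (h u - h l)) = 0" if "u \<in> I" for u
    using forest_sum_harmonic[OF fin(2), where u = u and N = N and b = b
        and \<phi> = "\<lambda>x. if x = i then 0 else 1"] sub b[OF that] that
    unfolding h_def by auto
  have "(\<Sum>l\<in>N. meta_weight N a I i l * h l) =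
      forest_sum N a I (\<lambda>r. \<Sum>l\<in>N. a i l * h (r l))"
    unfolding sum_meta_weight[OF fin(1) sub(3) IN] forest_sum_insert[OF finI iI]
    by (rule forest_sum_cong) (use hi iI in \<open>auto intro!: sum.cong\<close>)
  also have "\<dots> = (\<Sum>l\<in>N. a i l * (forest_sum N a I (\<lambda>_. 1) * h l))"
    unfolding forest_sum_sum forest_sum_mult
    using forest_sum_root_harmonic[OF finI harmonic] by simp
  finally show ?thesis unfolding row by (simp add: sum_distrib_left mult_ac)
qed

text \<open>Replaces one row at a time; the rows in \<open>I\<close> keep the weights
  \<open>a\<close>, as \<open>forest_sum_meta_row\<close> demands.\<close>

lemma forest_sum_meta_rows:
  fixes a :: "'v \<Rightarrow> 'v \<Rightarrow> 'a::comm_ring_1"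
  assumes fin: "finite N" and "D \<subseteq> N" "I \<subseteq> D"
    and J: "finite J" "J \<subseteq> D" "J \<inter> I = {}"
  shows "forest_sum N (\<lambda>i. if i \<in> J then meta_weight N a I i else a i) D (\<lambda>_. 1) =
    forest_sum N a I (\<lambda>_. 1) ^ card J * forest_sum N a D (\<lambda>_. 1)"
  using J
proof (induction J rule: finite_induct)
  case (insert i J)
  define b where "b = (\<lambda>i. if i \<in> J then meta_weight N a I i else a i)"
  have 1: "(\<lambda>j. if j \<in> insert i J then meta_weight N a I j else a j) =
      b(i := meta_weight N a I i)" and 2: "b(i := a i) = b"
    using insert by (auto simp: b_def)
  have D: "D = insert i (D - {i})" using insert by auto
  have "finite (D - {i})" using assms finite_subset by blast
  then have "forest_sum N (b(i := meta_weight N a I i)) (insert i (D - {i})) (\<lambda>_. 1) =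
    forest_sum N a I (\<lambda>_. 1) * forest_sum N (b(i := a i)) (insert i (D - {i})) (\<lambda>_. 1)"
    by (rule forest_sum_meta_row[OF fin]) (use assms insert in \<open>auto simp: b_def\<close>)
  then show ?case
    using insert unfolding 1 2 D[symmetric] by (simp add: b_def mult_ac)
qed simp

text \<open>The rows in \<open>J\<close> have weight zero into \<open>I\<close>, so only
  \<open>p\<close> enters \<open>I\<close> from outside. Its original out-edge followed by the
  forest on \<open>I\<close> makes up its meta-row, with no extra factor. \<open>\<Phi>\<close> may
  look only at nodes that survive the contraction.\<close>

lemma forest_sum_contract:
  fixes a b :: "'v \<Rightarrow> 'v \<Rightarrow> 'a::comm_ring_1"
  assumes fin: "finite N" and "I \<subseteq> N" and p: "p \<in> N - I"
    and J: "finite J" "J \<subseteq> N - I" "p \<notin> J"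
    and b: "\<And>i. i \<in> J \<Longrightarrow> b i = meta_weight N a I i" "\<And>i. i \<in> insert p I \<Longrightarrow> b i = a i"
    and \<Phi>: "\<And>r s. (\<And>x. x \<in> N - I \<Longrightarrow> r x = s x) \<Longrightarrow> \<Phi> r = \<Phi> s"
  shows "forest_sum N b (J \<union> insert p I) \<Phi> =
    forest_sum (N - I) (meta_weight N a I) (insert p J) \<Phi>"
  using J b(1) \<Phi>
proof (induction J arbitrary: \<Phi> rule: finite_induct)
  case empty
  have finI: "finite I" using assms finite_subset by blast
  let ?\<Psi> = "\<lambda>j. \<Phi> (\<lambda>x. if x = p then j else x)"
  have "forest_sum N b (insert p I) \<Phi> = forest_sum N a (insert p I) \<Phi>"
    by (rule forest_sum_weight_cong) (simp add: b(2))
  also have "\<dots> = forest_sum N a (insert p I) (\<lambda>r. ?\<Psi> (r p))"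
    by (rule forest_sum_cong, rule empty.prems(4)) (use p in auto)
  also have "\<dots> = (\<Sum>j\<in>N. meta_weight N a I p j * ?\<Psi> j)"
    by (rule sum_meta_weight[symmetric]) (use assms in auto)
  \<comment> \<open>Targets in \<open>I\<close> have weight zero, and so has \<open>p\<close>, which
    agrees with the exclusion of the loop at \<open>p\<close>.\<close>
  also have "\<dots> = (\<Sum>j\<in>N - I. if j = p then 0 else meta_weight N a I p j * ?\<Psi> j)"
    by (rule sum.mono_neutral_cong_right) (use fin in \<open>auto simp: meta_weight_nonroot\<close>)
  also have "\<dots> = forest_sum (N - I) (meta_weight N a I) (insert p {}) \<Phi>"
    by (simp add: forest_sum_insert forest_sum_empty)
  finally show ?case by simp
next
  case (insert u J)
  have finI: "finite I" using assms finite_subset by blast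
  let ?\<Psi> = "\<lambda>r. \<Sum>l\<in>N - I. if r l = u then 0 else
    meta_weight N a I u l * \<Phi> (\<lambda>x. if r x = u then r l else r x)"
  have u: "u \<notin> J \<union> insert p I" "u \<notin> insert p J"
    using insert.hyps insert.prems(1,2) by auto
  have bu: "b u = meta_weight N a I u" by (rule insert.prems(3)) simp
  have "forest_sum N b (insert u J \<union> insert p I) \<Phi> =
      forest_sum N b (insert u (J \<union> insert p I)) \<Phi>" by (simp only: Un_insert_left)
  also have "\<dots> = forest_sum N b (J \<union> insert p I) ?\<Psi>"
    unfolding forest_sum_insert[OF finite_UnI[OF insert.hyps(1) finite.insertI[OF finI]] u(1)] bu
    by (intro forest_sum_cong sum.mono_neutral_right)
      (use fin in \<open>auto simp: meta_weight_nonroot\<close>)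
  \<comment> \<open>The induction hypothesis is applied to a new observable, so its dependence on
    surviving nodes alone must be established.\<close>
  also have "\<dots> = forest_sum (N - I) (meta_weight N a I) (insert p J) ?\<Psi>"
  proof (rule insert.IH)
    fix r s :: "'v \<Rightarrow> 'v"
    assume rs: "\<And>x. x \<in> N - I \<Longrightarrow> r x = s x"
    have "\<Phi> (\<lambda>x. if r x = u then r l else r x) = \<Phi> (\<lambda>x. if s x = u then s l else s x)"
      if "l \<in> N - I" for l
      by (rule insert.prems(4)) (use rs that in auto)
    then show "?\<Psi> r = ?\<Psi> s" using rs by (intro sum.cong) auto
  qed (use insert.prems(1-3) in auto)
  also have "\<dots> = forest_sum (N - I) (meta_weight N a I) (insert u (insert p J)) \<Phi>"
    by (rule forest_sum_insert[OF _ u(2), symmetric]) (simp add: insert.hyps(1))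
  finally show ?case by (simp add: insert_commute)
qed

text \<open>Evaluates one mixed sum twice: meta-rows on \<open>J\<close> with original rows on
  \<open>I\<close> and \<open>p\<close> can be turned back into original rows, or
  contracted.\<close>

lemma forest_sum_condense:
  fixes a :: "'v \<Rightarrow> 'v \<Rightarrow> 'a::comm_ring_1"
  assumes "finite N" "I \<subseteq> N" "p \<in> N - I" "finite J" "J \<subseteq> N - I" "p \<notin> J"
  shows "forest_sum N a (J \<union> insert p I) (\<lambda>_. 1) * forest_sum N a I (\<lambda>_. 1) ^ card J =
    forest_sum (N - I) (meta_weight N a I) (insert p J) (\<lambda>_. 1)"
proof -
  let ?b = "\<lambda>i. if i \<in> J then meta_weight N a I i else a i"
  have "forest_sum N ?b (J \<union> insert p I) (\<lambda>_. 1) =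
      forest_sum (N - I) (meta_weight N a I) (insert p J) (\<lambda>_. 1)"
    by (rule forest_sum_contract) (use assms in auto)
  moreover have "forest_sum N ?b (J \<union> insert p I) (\<lambda>_. 1) =
      forest_sum N a I (\<lambda>_. 1) ^ card J * forest_sum N a (J \<union> insert p I) (\<lambda>_. 1)"
    by (rule forest_sum_meta_rows) (use assms in auto)
  ultimately show ?thesis by (simp add: mult.commute)
qed


section \<open>Forests as edge sets\<close>

definition graph :: "'v set \<Rightarrow> ('v \<Rightarrow> 'v) \<Rightarrow> ('v \<times> 'v) set" where
  "graph D f = (\<lambda>i. (i, f i)) ` D"

lemma mem_graph [simp]: "(x, y) \<in> graph D f \<longleftrightarrow> x \<in> D \<and> y = f x"
  by (auto simp: graph_def)

text \<open>\<open>leads\<close> reports only end points, hence the restriction to roots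
  \<open>j\<close>.\<close>

lemma graph_rtrancl_iff:
  assumes "j \<notin> D"
  shows "(i, j) \<in> (graph D f)\<^sup>* \<longleftrightarrow> leads D f i j"
proof
  assume "(i, j) \<in> (graph D f)\<^sup>*"
  then show "leads D f i j"
    by (induction rule: converse_rtrancl_induct) (use assms in \<open>auto intro: leads.intros\<close>)
next
  assume "leads D f i j"
  then show "(i, j) \<in> (graph D f)\<^sup>*"
  proof (induction rule: leads.induct)
    case (step x y)
    then have "(x, f x) \<in> graph D f" by simp
    then show ?case using step.IH by (rule converse_rtrancl_into_rtrancl)
  qed simp
qed

text \<open>Finiteness turns acyclicity into well-foundedness along the edges. Conversely, out-edges
  being unique, a cycle through \<open>x\<close> also passes through \<open>f x\<close>, and so on
  up to the root, which has no out-edge.\<close>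

lemma acyclic_graph_iff:
  assumes "finite D"
  shows "acyclic (graph D f) \<longleftrightarrow> terminating D f"
proof
  assume "acyclic (graph D f)"
  then have wf: "wf ((graph D f)\<inverse>)"
    using assms by (intro finite_acyclic_wf_converse) (simp_all add: graph_def)
  have "\<exists>y. leads D f x y" for x
    using wf
  proof (induction x rule: wf_induct_rule)
    case (less x)
    show ?case
    proof (cases "x \<in> D")
      case True
      then have "\<exists>y. leads D f (f x) y" by (intro less) simp
      then show ?thesis using True leads.step by metis
    next
      case False
      then show ?thesis using leads.stop by metis
    qed
  qed
  then show "terminating D f" by (simp add: terminating_def)
next
  assume T: "terminating D f"
  have "(x, x) \<notin> (graph D f)\<^sup>+" if "leads D f x y" for x y
    using that
  proof (induction rule: leads.induct)
    case (stop x)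
    then show ?case by (auto dest: tranclD)
  next
    case (step x y)
    show ?case
    proof
      assume "(x, x) \<in> (graph D f)\<^sup>+"
      then have "(f x, x) \<in> (graph D f)\<^sup>*" by (auto dest: tranclD)
      then have "(f x, f x) \<in> (graph D f)\<^sup>+"
        using step.hyps(1) by (intro rtrancl_into_trancl1) auto
      then show False using step.IH by contradiction
    qed
  qed
  then show "acyclic (graph D f)" using T unfolding acyclic_def terminating_def by blast
qed

lemma bij_betw_graph_rforests:
  assumes U: "U \<subseteq> {0..n}"
  shows "bij_betw (graph ({0..n} - U))
    {f \<in> ({0..n} - U) \<rightarrow>\<^sub>E {0..n}. terminating ({0..n} - U) f} (rforests n U)"
proof -
  let ?D = "{0..n} - U"
  have "inj_on (graph ?D) {f \<in> ?D \<rightarrow>\<^sub>E {0..n}. terminating ?D f}"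
  proof (rule inj_onI)
    fix f g assume f: "f \<in> {f \<in> ?D \<rightarrow>\<^sub>E {0..n}. terminating ?D f}"
      and g: "g \<in> {f \<in> ?D \<rightarrow>\<^sub>E {0..n}. terminating ?D f}" and eq: "graph ?D f = graph ?D g"
    have "f x = g x" if "x \<in> ?D" for x
      using that eq mem_graph[of x "f x" ?D f] mem_graph[of x "f x" ?D g] by blast
    then show "f = g" using f g by (blast intro: PiE_ext)
  qed
  moreover have "graph ?D f \<in> rforests n U"
    if "f \<in> ?D \<rightarrow>\<^sub>E {0..n}" "terminating ?D f" for f
  proof -
    have "Domain (graph ?D f) = ?D" by (auto simp: Domain_iff)
    moreover have "graph ?D f \<subseteq> {0..n} \<times> {0..n}"
      using that(1) unfolding graph_def by blast
    moreover have "single_valued (graph ?D f)" by (auto simp: single_valued_def)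
    ultimately show ?thesis
      using U that(2) by (auto simp: rforests_def rooted_forest_def forest_roots_def acyclic_graph_iff)
  qed
  moreover have "F \<in> graph ?D ` {f \<in> ?D \<rightarrow>\<^sub>E {0..n}. terminating ?D f}"
    if F: "F \<in> rforests n U" for F
  proof -
    have sub: "F \<subseteq> {0..n} \<times> {0..n}" and ac: "acyclic F" and sv: "single_valued F"
      and "{0..n} - Domain F = U"
      using F by (auto simp: rforests_def rooted_forest_def forest_roots_def)
    then have dom: "Domain F = ?D" by blast
    define f where "f = (\<lambda>i\<in>?D. THE j. (i, j) \<in> F)"
    have f: "(i, j) \<in> F \<longleftrightarrow> i \<in> ?D \<and> j = f i" for i j
    proof (cases "i \<in> ?D")
      case True
      then obtain l where l: "(i, l) \<in> F" using dom by blast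
      then have "(THE j. (i, j) \<in> F) = l"
        using sv by (blast intro: the_equality dest: single_valuedD)
      then show ?thesis using True l sv by (auto simp: f_def dest: single_valuedD)
    next
      case False
      then show ?thesis using dom by blast
    qed
    have "F = graph ?D f" by (rule set_eqI) (auto simp: f simp del: Diff_iff)
    moreover have "f \<in> ?D \<rightarrow>\<^sub>E {0..n}"
    proof (rule PiE_I)
      fix i assume "i \<in> ?D"
      then show "f i \<in> {0..n}" using f[of i "f i"] sub by blast
    qed (auto simp: f_def)
    moreover have "terminating ?D f"
      using ac \<open>F = graph ?D f\<close> acyclic_graph_iff[of ?D f] by simp
    ultimately show ?thesis by blast
  qed
  ultimately show ?thesis unfolding bij_betw_def by blast
qed

lemma rforests_root:
  assumes F: "F \<in> rforests n U" and U: "U \<subseteq> {0..n}" and i: "i \<in> {0..n}"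
  shows "\<exists>!j. j \<in> U \<and> meta_edge F i j"
proof -
  let ?D = "{0..n} - U"
  obtain f where f: "f \<in> ?D \<rightarrow>\<^sub>E {0..n}" "terminating ?D f" and F: "F = graph ?D f"
    using F bij_betw_imp_surj_on[OF bij_betw_graph_rforests[OF U]] by blast
  have leads: "leads ?D f i (root ?D f i)" by (rule leads_root[OF f(2)])
  have "root ?D f i \<in> U"
    using leads_mem[OF leads i] root_notin[OF f(2), of i] f(1) by blast
  moreover have "meta_edge F i j \<longleftrightarrow> leads ?D f i j" if "j \<in> U" for j
    unfolding meta_edge_def F by (rule graph_rtrancl_iff) (use that in blast)
  ultimately show ?thesis using leads leads_unique by metis
qed

lemma forest_weight_graph: "forest_weight a (graph D f) = (\<Prod>i\<in>D. a i (f i))"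
  unfolding forest_weight_def graph_def by (subst prod.reindex) (auto simp: inj_on_def)

lemma sum_rforests:
  assumes U: "U \<subseteq> {0..n}"
  shows "(\<Sum>F\<in>rforests n U. forest_weight a F) = forest_sum {0..n} a ({0..n} - U) (\<lambda>_. 1)"
  unfolding sum.reindex_bij_betw[OF bij_betw_graph_rforests[OF U], symmetric]
    forest_sum_def forest_weight_graph mult_1_right
  by (rule sum.inter_filter) (simp add: finite_PiE)

lemma sum_rforests_meta:
  assumes U: "U \<subseteq> {0..n}" and j: "j \<in> U"
  shows "(\<Sum>F\<in>rforests_meta n U i j. forest_weight a F) =
    forest_sum {0..n} a ({0..n} - U) (\<lambda>r. if r i = j then 1 else 0)"
proof -
  let ?D = "{0..n} - U"
  have meta: "meta_edge (graph ?D f) i j \<longleftrightarrow> root ?D f i = j" if "terminating ?D f" for f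
  proof -
    have "meta_edge (graph ?D f) i j \<longleftrightarrow> leads ?D f i j"
      unfolding meta_edge_def by (rule graph_rtrancl_iff) (use j in blast)
    then show ?thesis using leads_root[OF that, of i] root_eqI by metis
  qed
  have "(\<Sum>F\<in>rforests_meta n U i j. forest_weight a F) =
      (\<Sum>F\<in>rforests n U. if meta_edge F i j then forest_weight a F else 0)"
    unfolding rforests_meta_def by (rule sum.inter_filter[OF finite_rforests])
  also have "\<dots> = (\<Sum>f | f \<in> ?D \<rightarrow>\<^sub>E {0..n} \<and> terminating ?D f.
      (\<Prod>i\<in>?D. a i (f i)) * (if root ?D f i = j then 1 else 0))"
    unfolding sum.reindex_bij_betw[OF bij_betw_graph_rforests[OF U], symmetric]
      forest_weight_graph
    by (rule sum.cong) (simp_all add: meta)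
  also have "\<dots> = forest_sum {0..n} a ?D (\<lambda>r. if r i = j then 1 else 0)"
    unfolding forest_sum_def by (rule sum.inter_filter) (simp add: finite_PiE)
  finally show ?thesis .
qed

section \<open>Cycles and the tuples on the right-hand side\<close>

text \<open>A minimal nonempty \<open>f\<close>-invariant subset of \<open>D\<close> is permuted by
  \<open>f\<close>; \<open>\<sigma>\<close> is the identity elsewhere. The last conclusion yields
  \<open>\<sigma> \<noteq> id\<close> once \<open>f\<close> has no fixed points in
  \<open>D\<close>.\<close>

lemma not_terminating_permutes:
  assumes fin: "finite D" and T: "\<not> terminating D f"
  obtains \<sigma> where "\<sigma> permutes D" "\<And>i. \<sigma> i = f i \<or> \<sigma> i = i" "\<exists>i\<in>D. \<sigma> i = f i"
proof -
  \<comment> \<open>The points whose walk never ends form a nonempty invariant set to start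
    from.\<close>
  define X where "X = {x. \<nexists>y. leads D f x y}"
  have X_D: "x \<in> D" if "x \<in> X" for x
    by (rule ccontr) (use that leads.stop[of x D f] in \<open>simp add: X_def\<close>)
  have X_f: "f x \<in> X" if "x \<in> X" for x
    using that leads.step[OF X_D[OF that], of f] by (auto simp: X_def)
  have "X \<noteq> {}" using T by (simp add: X_def terminating_def)
  define P where "P S \<longleftrightarrow> S \<subseteq> D \<and> S \<noteq> {} \<and> f ` S \<subseteq> S" for S
  have "\<exists>S. P S \<and> (\<forall>S'. P S' \<longrightarrow> S' \<subseteq> S \<longrightarrow> S' = S)"
  proof -
    have "finite {S. P S}" by (rule finite_subset[of _ "Pow D"]) (use fin in \<open>auto simp: P_def\<close>)
    moreover have "P X" using \<open>X \<noteq> {}\<close> X_D X_f unfolding P_def by blast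
    then have "{S. P S} \<noteq> {}" by blast
    ultimately have "\<exists>S\<in>{S. P S}. \<forall>S'\<in>{S. P S}. S' \<subseteq> S \<longrightarrow> S = S'"
      by (rule finite_has_minimal)
    then show ?thesis by blast
  qed
  then obtain S where S: "S \<subseteq> D" "S \<noteq> {}" "f ` S \<subseteq> S"
    and minimal: "\<And>S'. P S' \<Longrightarrow> S' \<subseteq> S \<Longrightarrow> S' = S"
    unfolding P_def by blast
  \<comment> \<open>The image is again invariant, so minimality makes \<open>f\<close> surjective on
    the finite set \<open>S\<close>, hence bijective.\<close>
  have "f ` S = S" by (rule minimal) (use S in \<open>auto simp: P_def\<close>)
  moreover have "finite S" using S(1) fin finite_subset by blast
  ultimately have bij: "bij_betw f S S"
    unfolding bij_betw_def by (simp add: eq_card_imp_inj_on)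
  define \<sigma> where "\<sigma> = (\<lambda>i. if i \<in> S then f i else i)"
  have "bij_betw \<sigma> S S" using bij bij_betw_cong[of S \<sigma> f S] by (simp add: \<sigma>_def)
  then have "\<sigma> permutes S" by (rule bij_imp_permutes) (simp add: \<sigma>_def)
  then have "\<sigma> permutes D" using S(1) by (rule permutes_subset)
  then show ?thesis by (rule that) (use S in \<open>auto simp: \<sigma>_def split: if_splits\<close>)
qed

text \<open>\<open>\<tau> i\<close> is the root that \<open>i\<close> reaches in \<open>F i\<close>.
  Here \<open>R_perm\<close> is applied to maps that need not be permutations and may take the value
  0.\<close>

lemma R_NF_eq:
  assumes "k \<le> n"
  shows "R_NF n k = (\<Union>\<tau>\<in>{\<tau> \<in> {1..k} \<rightarrow>\<^sub>E {0..k}. terminating {1..k} \<tau>}. R_perm n k \<tau>)"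
proof (intro equalityI subsetI)
  fix F assume F: "F \<in> R_NF n k"
  then have ext: "F \<in> extensional {1..k}" and Fi: "\<And>i. i \<in> {1..k} \<Longrightarrow> F i \<in> rforests n ({0..k} - {i})"
    by (auto simp: R_NF_def R_perm_def rforests_meta_refl PiE_iff)
  have "\<exists>j. j \<in> {0..k} - {i} \<and> meta_edge (F i) i j" if "i \<in> {1..k}" for i
  proof -
    have "{0..k} - {i} \<subseteq> {0..n}" "i \<in> {0..n}" using that assms by auto
    then show ?thesis using rforests_root[OF Fi[OF that]] by blast
  qed
  then obtain \<rho> where \<rho>: "\<And>i. i \<in> {1..k} \<Longrightarrow> \<rho> i \<in> {0..k} - {i} \<and> meta_edge (F i) i (\<rho> i)"
    by metis
  define \<tau> where "\<tau> = restrict \<rho> {1..k}"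
  have \<tau>: "\<tau> i \<in> {0..k} - {i}" "meta_edge (F i) i (\<tau> i)" if "i \<in> {1..k}" for i
    using \<rho>[OF that] that by (simp_all add: \<tau>_def)
  \<comment> \<open>The trivial meta-edge from \<open>i\<close> to \<open>i\<close> is always
    present, so \<open>\<sigma>\<close> may follow \<open>\<tau>\<close> at some indices and fix the
    others.\<close>
  have mem: "F \<in> R_perm n k \<sigma>" if "\<And>i. i \<in> {1..k} \<Longrightarrow> \<sigma> i = \<tau> i \<or> \<sigma> i = i" for \<sigma>
    unfolding R_perm_def
  proof (rule PiE_I)
    fix i assume i: "i \<in> {1..k}"
    show "F i \<in> rforests_meta n ({0..k} - {i}) i (\<sigma> i)"
      using that[OF i] \<tau>(2)[OF i] Fi[OF i] by (auto simp: rforests_meta_def meta_edge_def)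
  qed (use ext in \<open>auto simp: extensional_def\<close>)
  have "terminating {1..k} \<tau>"
  proof (rule ccontr)
    assume "\<not> terminating {1..k} \<tau>"
    then obtain \<sigma> where \<sigma>: "\<sigma> permutes {1..k}" "\<And>i. \<sigma> i = \<tau> i \<or> \<sigma> i = i"
      "\<exists>i\<in>{1..k}. \<sigma> i = \<tau> i"
      using not_terminating_permutes[of "{1..k}" \<tau>] by blast
    from \<sigma>(3) \<tau>(1) have "\<sigma> \<noteq> id" by fastforce
    with \<sigma>(1) mem[of \<sigma>] \<sigma>(2) F show False unfolding R_NF_def by blast
  qed
  moreover have "\<tau> \<in> {1..k} \<rightarrow>\<^sub>E {0..k}"
    by (rule PiE_I) (use \<tau>(1) in \<open>auto simp: \<tau>_def\<close>)
  ultimately show "F \<in> (\<Union>\<tau>\<in>{\<tau> \<in> {1..k} \<rightarrow>\<^sub>E {0..k}. terminating {1..k} \<tau>}. R_perm n k \<tau>)"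
    using mem[of \<tau>] by blast
next
  fix F assume "F \<in> (\<Union>\<tau>\<in>{\<tau> \<in> {1..k} \<rightarrow>\<^sub>E {0..k}. terminating {1..k} \<tau>}. R_perm n k \<tau>)"
  then obtain \<tau> where \<tau>: "\<tau> \<in> {1..k} \<rightarrow>\<^sub>E {0..k}" "terminating {1..k} \<tau>" and F: "F \<in> R_perm n k \<tau>"
    by blast
  have "F \<in> R_perm n k id"
    using F by (auto simp: R_perm_def PiE_iff rforests_meta_def meta_edge_def)
  moreover have "F \<notin> R_perm n k \<sigma>" if \<sigma>: "\<sigma> permutes {1..k}" "\<sigma> \<noteq> id" for \<sigma>
  proof
    assume F\<sigma>: "F \<in> R_perm n k \<sigma>"
    let ?S = "{i. \<sigma> i \<noteq> i}"
    have S: "?S \<subseteq> {1..k}" using \<sigma>(1) permutes_not_in by fastforce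
    \<comment> \<open>A moved \<open>i\<close> reaches \<open>\<sigma> i\<close>, which is a root of
      \<open>F i\<close>; as \<open>i\<close> reaches only one root, it equals
      \<open>\<tau> i\<close>.\<close>
    have "\<sigma> i = \<tau> i" if "\<sigma> i \<noteq> i" for i
    proof -
      have i: "i \<in> {1..k}" using S that by blast
      have "F i \<in> rforests n ({0..k} - {i})" "meta_edge (F i) i (\<sigma> i)" "meta_edge (F i) i (\<tau> i)"
        using F F\<sigma> i by (auto simp: R_perm_def PiE_iff rforests_meta_def)
      moreover have "\<tau> i \<in> {0..k} - {i}"
        using \<tau>(1) i terminating_no_fixpoint[OF \<tau>(2) i] by auto
      moreover have "\<sigma> i \<in> {1..k}" using permutes_in_image[OF \<sigma>(1)] i by blast
      then have "\<sigma> i \<in> {0..k} - {i}" using that by auto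
      moreover have "{0..k} - {i} \<subseteq> {0..n}" "i \<in> {0..n}" using i assms by auto
      ultimately show ?thesis using rforests_root by blast
    qed
    moreover have "\<sigma> (\<sigma> i) \<noteq> \<sigma> i" if "\<sigma> i \<noteq> i" for i
      using that permutes_inj[OF \<sigma>(1)] by (auto dest: injD)
    ultimately have "\<tau> ` ?S \<subseteq> ?S" by auto
    moreover obtain i where "i \<in> ?S" using \<sigma>(2) by (auto simp: fun_eq_iff)
    ultimately show False
      using not_leads_invariant[OF leads_root[OF \<tau>(2), of i] _ S] by blast
  qed
  ultimately show "F \<in> R_NF n k" unfolding R_NF_def by blast
qed

text \<open>A terminating map has no fixed points on \<open>{1..k}\<close>, so
  \<open>\<tau> i\<close> is the root reached from \<open>i\<close> in \<open>F i\<close> and is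
  determined by \<open>F\<close>.\<close>

lemma R_perm_disjoint:
  assumes "k \<le> n"
    and "\<tau> \<in> {1..k} \<rightarrow>\<^sub>E {0..k}" "terminating {1..k} \<tau>"
    and "\<sigma> \<in> {1..k} \<rightarrow>\<^sub>E {0..k}" "terminating {1..k} \<sigma>"
    and F: "F \<in> R_perm n k \<tau>" "F \<in> R_perm n k \<sigma>"
  shows "\<tau> = \<sigma>"
proof (rule PiE_ext[OF assms(2,4)])
  fix i assume i: "i \<in> {1..k}"
  have "F i \<in> rforests n ({0..k} - {i})" "meta_edge (F i) i (\<sigma> i)" "meta_edge (F i) i (\<tau> i)"
    using F i by (auto simp: R_perm_def PiE_iff rforests_meta_def)
  moreover have "\<tau> i \<in> {0..k} - {i}" "\<sigma> i \<in> {0..k} - {i}"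
    using assms i terminating_no_fixpoint[OF assms(3) i] terminating_no_fixpoint[OF assms(5) i]
    by auto
  moreover have "{0..k} - {i} \<subseteq> {0..n}" "i \<in> {0..n}" using i assms by auto
  ultimately show "\<tau> i = \<sigma> i" using rforests_root by blast
qed

section \<open>Both sides as forest sums\<close>

text \<open>For fixed \<open>\<tau>\<close> the tuples form a product set, so their sum factors into
  meta-weights; summing over terminating \<open>\<tau>\<close> gives a forest sum on
  \<open>{0..k}\<close>.\<close>

lemma sum_R_NF:
  assumes "k \<le> n"
  shows "(\<Sum>F\<in>R_NF n k. \<Prod>i\<in>{1..k}. forest_weight a (F i)) =
    forest_sum {0..k} (meta_weight {0..n} a {k+1..n}) {1..k} (\<lambda>_. 1)"
proof -
  let ?A = "{\<tau> \<in> {1..k} \<rightarrow>\<^sub>E {0..k}. terminating {1..k} \<tau>}"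
  have finA: "finite ?A" by (simp add: finite_PiE)
  have finR: "finite (R_perm n k \<tau>)" for \<tau>
    unfolding R_perm_def by (rule finite_PiE) (auto simp: rforests_meta_def finite_rforests)
  have "(\<Sum>F\<in>R_NF n k. \<Prod>i\<in>{1..k}. forest_weight a (F i)) =
      (\<Sum>\<tau>\<in>?A. \<Sum>F\<in>R_perm n k \<tau>. \<Prod>i\<in>{1..k}. forest_weight a (F i))"
    unfolding R_NF_eq[OF assms]
    by (rule sum.UNION_disjoint[OF finA]) (use finR R_perm_disjoint[OF assms] in blast)+
  also have "\<dots> = (\<Sum>\<tau>\<in>?A. \<Prod>i\<in>{1..k}. meta_weight {0..n} a {k+1..n} i (\<tau> i))"
  proof (rule sum.cong)
    fix \<tau> assume \<tau>: "\<tau> \<in> ?A"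
    have "(\<Sum>F\<in>R_perm n k \<tau>. \<Prod>i\<in>{1..k}. forest_weight a (F i)) =
      (\<Prod>i\<in>{1..k}. \<Sum>F\<in>rforests_meta n ({0..k} - {i}) i (\<tau> i). forest_weight a F)"
      unfolding R_perm_def
      by (rule prod_sum_PiE[symmetric]) (auto simp: rforests_meta_def finite_rforests)
    also have "\<dots> = (\<Prod>i\<in>{1..k}. meta_weight {0..n} a {k+1..n} i (\<tau> i))"
    proof (rule prod.cong)
      fix i assume i: "i \<in> {1..k}"
      have "{0..k} - {i} \<subseteq> {0..n}" using assms by auto
      moreover have "\<tau> i \<in> {0..k} - {i}"
        using \<tau> i terminating_no_fixpoint[of "{1..k}" \<tau> i] by auto
      moreover have "{0..n} - ({0..k} - {i}) = insert i {k+1..n}" using i assms by auto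
      ultimately show "(\<Sum>F\<in>rforests_meta n ({0..k} - {i}) i (\<tau> i). forest_weight a F) =
          meta_weight {0..n} a {k+1..n} i (\<tau> i)"
        by (simp add: sum_rforests_meta meta_weight_def)
    qed simp
    finally show "(\<Sum>F\<in>R_perm n k \<tau>. \<Prod>i\<in>{1..k}. forest_weight a (F i)) =
      (\<Prod>i\<in>{1..k}. meta_weight {0..n} a {k+1..n} i (\<tau> i))" .
  qed simp
  also have "\<dots> = forest_sum {0..k} (meta_weight {0..n} a {k+1..n}) {1..k} (\<lambda>_. 1)"
    unfolding forest_sum_def mult_1_right by (rule sum.inter_filter) (simp add: finite_PiE)
  finally show ?thesis .
qed

lemma sum_R_prod:
  assumes "1 \<le> k" "k \<le> n"
  shows "(\<Sum>F\<in>R_prod n k. \<Prod>i\<in>{1..k}. forest_weight a (F i)) =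
    forest_sum {0..n} a {1..n} (\<lambda>_. 1) * forest_sum {0..n} a {k+1..n} (\<lambda>_. 1) ^ (k - 1)"
proof -
  have "(\<Sum>F\<in>R_prod n k. \<Prod>i\<in>{1..k}. forest_weight a (F i)) =
      (\<Prod>i\<in>{1..k}. \<Sum>F\<in>(if i = 1 then rforests n {0} else rforests n {0..k}). forest_weight a F)"
    unfolding R_prod_def by (rule prod_sum_PiE[symmetric]) (auto simp: finite_rforests)
  also have "\<dots> = (\<Sum>F\<in>rforests n {0}. forest_weight a F) *
      (\<Prod>i\<in>{2..k}. \<Sum>F\<in>rforests n {0..k}. forest_weight a F)"
  proof -
    have "{1..k} = insert 1 {2..k}" using assms by auto
    moreover have "(\<Prod>i\<in>{2..k}. \<Sum>F\<in>(if i = 1 then rforests n {0} else rforests n {0..k}).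
        forest_weight a F) = (\<Prod>i\<in>{2..k}. \<Sum>F\<in>rforests n {0..k}. forest_weight a F)"
      by (rule prod.cong) auto
    ultimately show ?thesis by simp
  qed
  also have "{0..n} - {0} = {1..n}" "{0..n} - {0..k} = {k+1..n}" by auto
  then have "(\<Sum>F\<in>rforests n {0}. forest_weight a F) *
      (\<Prod>i\<in>{2..k}. \<Sum>F\<in>rforests n {0..k}. forest_weight a F) =
    forest_sum {0..n} a {1..n} (\<lambda>_. 1) * forest_sum {0..n} a {k+1..n} (\<lambda>_. 1) ^ (k - 1)"
    using assms by (simp add: sum_rforests)
  finally show ?thesis .
qed

theorem theorem1p0p4:
  fixes n k :: nat
    and a :: "nat \<Rightarrow> nat \<Rightarrow> 'a::comm_ring_1"
  assumes "1 \<le> k" and "k \<le> n"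
  shows "(\<Sum>F\<in>R_prod n k. \<Prod>i\<in>{1..k}. forest_weight a (F i))
       = (\<Sum>F\<in>R_NF n k. \<Prod>i\<in>{1..k}. forest_weight a (F i))"
proof -
  have sets: "{2..k} \<union> insert 1 {k+1..n} = {1..n}" "{0..n} - {k+1..n} = {0..k}"
    "insert 1 {2..k} = {1..k}" and card: "card {2..k} = k - 1"
    using assms by auto
  \<comment> \<open>Node 1 serves as \<open>p\<close> and keeps its original row; the
    \<open>k - 1\<close> meta-rows of \<open>{2..k}\<close> account for the \<open>k - 1\<close>
    factors with roots \<open>{0..k}\<close>.\<close>
  have "forest_sum {0..n} a ({2..k} \<union> insert 1 {k+1..n}) (\<lambda>_. 1) *
      forest_sum {0..n} a {k+1..n} (\<lambda>_. 1) ^ card {2..k} =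
    forest_sum ({0..n} - {k+1..n}) (meta_weight {0..n} a {k+1..n}) (insert 1 {2..k}) (\<lambda>_. 1)"
    by (rule forest_sum_condense) (use assms in auto)
  then show ?thesis
    unfolding sets card sum_R_prod[OF assms] sum_R_NF[OF assms(2)] .
qed

end
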